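(* Let $a_1,\dots,a_m\in[-1,1]^d$ and $b_1,\dots,b_m\in\mathbb{R}$. Fix $k\in\{1,\dots,m\}$ and real parameters $R\ge 1$ and $r\ge 0$. Suppose that for every subset $J\subset\{1,\dots,m\}$ with $|J|=k$ there exists a point $x_J\in\mathbb{R}^d$ with $\|x_J\|_1\le R$ such that $$\max_{j\in J}|\langle a_j,x_J\rangle-b_j|\le r .$$ Then there exists a point $x\in\mathbb{R}^d$ with $\|x\|_1\le eR$ such that $$\max_{1\le i\le m}|\langle a_i,x\rangle-b_i|\le r+21\,R\,\sqrt{\frac{\ln d}{k}} .$$
   Context: Here $d$ and $m$ are positive integers, $\langle\cdot,\cdot\rangle$ is the standard inner product on $\mathbb{R}^d$, $\|x\|_1=\sum_{i=1}^d|x_i|$ is the $\ell_1$ norm, $e$ is the base of the natural logarithm, and $\ln$ is the natural logarithm.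
   Formalization: The case d = 1, k = 1, m ≥ 2 is excluded, since there ln d = 0 and the claim fails: with all a_i = 1, b_1 = 0, b_i = 1 for i ≥ 2, R = 1, r = 0, each single constraint is solvable but no x satisfies all of them. *)

theory Defs
  imports "HOL-Analysis.Analysis"
begin

definition l1_norm :: "real ^ 'd \<Rightarrow> real"
  where "l1_norm x = (\<Sum>l\<in>UNIV. \<bar>x $ l\<bar>)"

(* For d = 1 the error term with ln d vanishes, and for k = 1 the hypothesis then does not
   tie the constraints together: with all a_i = 1, b_1 = 0, b_2 = ... = b_m = 1, R = 1 and
   r = 0 it holds, but no single x satisfies the conclusion when m \<ge> 2.  A theorem with
   error term R * sqrt (ln d / k) must therefore exclude exactly d = 1, k = 1, m \<ge> 2. *)

end

theory Submission
  imports Defs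
begin

text \<open>
  By linear duality it suffices to find, for every convex combination \<open>(A, B)\<close> of the signed
  constraints \<open>(\<plusminus>a\<^sub>i, \<plusminus>b\<^sub>i)\<close>, a point of the \<open>\<ell>\<^sub>1\<close> ball of radius \<open>R\<close> at which
  \<open>\<langle>A, x\<rangle> - B \<le> r + \<epsilon>\<close>.  An empirical mean of \<open>k\<close> of the signed constraints approximates \<open>A\<close> up to
  \<open>O(\<surd>(ln d / k))\<close> in the maximum norm while its second component exceeds \<open>B\<close> by at most \<open>R\<close>
  times that, and the local solution of the sampled constraints is the required point.  The sample
  is found greedily, with the logarithm of the exponential moments of all coordinates as potential.
  This already gives the radius \<open>R\<close> and the constant \<open>6\<close> when \<open>d \<ge> 2\<close>; for \<open>d = 1\<close> Helly's theorem gives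
  an exact solution.
\<close>

section \<open>Balls of the sum norm\<close>

lemma l1_norm_triangle: "l1_norm (x + y) \<le> l1_norm x + l1_norm y"
  unfolding l1_norm_def sum.distrib[symmetric] by (intro sum_mono) (simp add: abs_triangle_ineq)

lemma l1_norm_scaleR: "l1_norm (c *\<^sub>R x) = \<bar>c\<bar> * l1_norm x"
  by (simp add: l1_norm_def abs_mult sum_distrib_left)

lemma convex_l1_ball: "convex {x. l1_norm x \<le> R}"
proof (rule convexI)
  fix x y :: "real ^ 'd" and u v :: real
  assume x: "x \<in> {x. l1_norm x \<le> R}" and y: "y \<in> {x. l1_norm x \<le> R}"
    and uv: "0 \<le> u" "0 \<le> v" "u + v = 1"
  have "l1_norm (u *\<^sub>R x + v *\<^sub>R y) \<le> u * l1_norm x + v * l1_norm y"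
    using l1_norm_triangle[of "u *\<^sub>R x" "v *\<^sub>R y"] uv by (simp add: l1_norm_scaleR)
  also have "\<dots> \<le> u * R + v * R"
    using x y uv by (intro add_mono mult_left_mono) auto
  also have "\<dots> = R"
    using uv by (simp flip: distrib_right)
  finally show "u *\<^sub>R x + v *\<^sub>R y \<in> {x. l1_norm x \<le> R}" by simp
qed

lemma compact_l1_ball: "compact {x. l1_norm x \<le> R}"
proof -
  have "closed {x :: real ^ 'd. l1_norm x \<le> R}"
    unfolding l1_norm_def by (intro closed_Collect_le continuous_intros)
  moreover have "bounded {x :: real ^ 'd. l1_norm x \<le> R}"
    unfolding bounded_iff l1_norm_def using norm_le_l1_cart by (intro exI[of _ R]) (auto intro: order_trans)
  ultimately show ?thesis by (simp add: compact_eq_bounded_closed)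
qed

text \<open>Hoelder's inequality for the dual pair of maximum norm and sum norm; it turns a
  coordinatewise sampling error into an error of the linear functional.\<close>

lemma inner_le_l1_norm:
  assumes "\<And>l. \<bar>a $ l\<bar> \<le> c"
  shows "a \<bullet> x \<le> c * l1_norm x"
proof -
  have "a \<bullet> x \<le> (\<Sum>l\<in>UNIV. c * \<bar>x $ l\<bar>)"
    unfolding inner_vec_def
  proof (rule sum_mono)
    fix l
    have "a $ l \<bullet> x $ l \<le> \<bar>a $ l\<bar> * \<bar>x $ l\<bar>"
      by (simp add: abs_mult[symmetric])
    also have "\<dots> \<le> c * \<bar>x $ l\<bar>"
      using assms by (intro mult_right_mono) auto
    finally show "a $ l \<bullet> x $ l \<le> c * \<bar>x $ l\<bar>" .
  qed
  then show ?thesis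
    by (simp add: l1_norm_def sum_distrib_left)
qed

section \<open>Linear duality over a compact convex set\<close>

text \<open>The set \<open>Q\<close> of constraints violated at every point of \<open>S\<close> is
  convex and, by \<open>sol\<close>, disjoint from \<open>K\<close>. A hyperplane separating the two
  in the space of pairs \<open>(A, B)\<close> turns out not to be vertical, and its normal, rescaled
  to last component 1, encodes the point sought.\<close>

lemma affine_minimax_le:
  fixes S :: "'a::euclidean_space set" and K :: "('a \<times> real) set"
  assumes S: "convex S" "compact S" and "convex K" "K \<noteq> {}"
    and sol: "\<And>A B. (A, B) \<in> K \<Longrightarrow> \<exists>x\<in>S. A \<bullet> x \<le> B + t"
  shows "\<exists>x\<in>S. \<forall>(A, B)\<in>K. A \<bullet> x \<le> B + t"
proof -
  define Q where "Q = {(A, B). \<forall>x\<in>S. B + t < A \<bullet> x}"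
  have "convex Q"
  proof (rule convexI)
    fix p q :: "'a \<times> real" and u v :: real
    assume p: "p \<in> Q" and q: "q \<in> Q" and uv: "0 \<le> u" "0 \<le> v" "u + v = 1"
    have "u * snd p + v * snd q + t < (u *\<^sub>R fst p + v *\<^sub>R fst q) \<bullet> x" if "x \<in> S" for x
    proof -
      have "snd p + t < fst p \<bullet> x" "snd q + t < fst q \<bullet> x"
        using p q that by (auto simp: Q_def)
      then have "u * (snd p + t) + v * (snd q + t) < u * (fst p \<bullet> x) + v * (fst q \<bullet> x)"
        using uv by (smt (verit) mult_left_mono mult_strict_left_mono)
      moreover have "u * (snd p + t) + v * (snd q + t) = u * snd p + v * snd q + (u + v) * t"
        by (simp add: algebra_simps)
      ultimately show ?thesis
        using uv by (simp add: inner_add_left)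
    qed
    then show "u *\<^sub>R p + v *\<^sub>R q \<in> Q"
      by (auto simp: Q_def case_prod_beta)
  qed
  moreover have "(0, - t - 1) \<in> Q"
    by (auto simp: Q_def)
  moreover have "Q \<inter> K = {}"
    using sol by (force simp: Q_def)
  ultimately obtain z c where z: "z \<noteq> 0" and Qc: "\<And>q. q \<in> Q \<Longrightarrow> z \<bullet> q \<le> c"
    and Kc: "\<And>q. q \<in> K \<Longrightarrow> c \<le> z \<bullet> q"
    using separating_hyperplane_sets[of Q K] \<open>convex K\<close> \<open>K \<noteq> {}\<close> by blast
  obtain y \<beta> where z_eq: "z = (y, \<beta>)" by (cases z)
  have Q_le: "y \<bullet> A + \<beta> * B \<le> c" if "\<And>x. x \<in> S \<Longrightarrow> B + t < A \<bullet> x" for A B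
    using Qc[of "(A, B)"] that by (auto simp: Q_def z_eq)
  \<comment> \<open>Used at both ends of the range of \<open>e\<close>: large \<open>e\<close>
    forces \<open>\<beta> \<ge> 0\<close>, and arbitrarily small \<open>e\<close> gives the final
    bound on \<open>K\<close>.\<close>
  have beta_le: "\<beta> * (- t - e) \<le> c" if "e > 0" for e
    using Q_le[of "- t - e" 0] that by auto
  have "\<beta> \<ge> 0"
  proof (rule ccontr)
    assume neg: "\<not> \<beta> \<ge> 0"
    define e where "e = (\<bar>c + \<beta> * t\<bar> + 1) / (- \<beta>)"
    have "e > 0"
      using neg by (auto simp: e_def field_simps)
    moreover have "\<beta> * e = - (\<bar>c + \<beta> * t\<bar> + 1)"
      using neg by (simp add: e_def field_simps)
    ultimately show False
      using beta_le[of e] by (simp add: algebra_simps)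
  qed
  moreover have "\<beta> \<noteq> 0"
  proof
    assume "\<beta> = 0"
    then have "y \<noteq> 0" using z z_eq by (auto simp: zero_prod_def)
    obtain M where M: "\<And>x. x \<in> S \<Longrightarrow> norm x \<le> M"
      using \<open>compact S\<close> compact_imp_bounded bounded_iff by metis
    \<comment> \<open>Since \<open>S\<close> is bounded, any \<open>A\<close> together with a
      sufficiently low \<open>B\<close> lies in \<open>Q\<close>. With \<open>\<beta> = 0\<close>
      the value of \<open>B\<close> does not enter the functional, so a multiple of \<open>y\<close>
      with \<open>y \<bullet> A > c\<close> is a contradiction.\<close>
    define A where "A = ((\<bar>c\<bar> + 1) / (y \<bullet> y)) *\<^sub>R y"
    have "y \<bullet> A + \<beta> * (- norm A * M - t - 1) \<le> c"
    proof (rule Q_le)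
      fix x assume "x \<in> S"
      have "\<bar>A \<bullet> x\<bar> \<le> norm A * norm x"
        by (rule Cauchy_Schwarz_ineq2)
      also have "\<dots> \<le> norm A * M"
        using M[OF \<open>x \<in> S\<close>] by (intro mult_left_mono) auto
      finally show "- norm A * M - t - 1 + t < A \<bullet> x" by simp
    qed
    moreover have "y \<bullet> A = \<bar>c\<bar> + 1"
      using \<open>y \<noteq> 0\<close> by (simp add: A_def)
    ultimately show False using \<open>\<beta> = 0\<close> by simp
  qed
  ultimately have "\<beta> > 0" by simp
  \<comment> \<open>With this choice the separating functional is
    \<open>\<beta> * (B - A \<bullet> x0)\<close>, a positive multiple of the slack of the
    constraint at \<open>x0\<close>.\<close>
  define x0 where "x0 = (- 1 / \<beta>) *\<^sub>R y"
  have y_eq: "y = - \<beta> *\<^sub>R x0"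
    using \<open>\<beta> > 0\<close> by (simp add: x0_def)
  have "x0 \<in> S"
  proof (rule ccontr)
    assume "x0 \<notin> S"
    then obtain A \<gamma> where A: "A \<bullet> x0 < \<gamma>" "\<And>x. x \<in> S \<Longrightarrow> \<gamma> < A \<bullet> x"
      using separating_hyperplane_closed_point[of S x0] S compact_imp_closed by blast
    define g where "g = \<beta> * (\<gamma> - A \<bullet> x0)"
    have "g > 0"
      using A \<open>\<beta> > 0\<close> by (simp add: g_def)
    \<comment> \<open>Every pair \<open>(s *\<^sub>R A, s * \<gamma> - t)\<close> with
      \<open>s > 0\<close> lies in \<open>Q\<close>, and the functional there is
      \<open>s * g - \<beta> * t\<close>; this \<open>s\<close> pushes it above
      \<open>c\<close>.\<close>
    define s where "s = (\<bar>c + \<beta> * t\<bar> + 1) / g"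
    have "s > 0" and sg: "s * g = \<bar>c + \<beta> * t\<bar> + 1"
      using \<open>g > 0\<close> by (simp_all add: s_def)
    have "y \<bullet> (s *\<^sub>R A) + \<beta> * (s * \<gamma> - t) \<le> c"
      using A(2) \<open>s > 0\<close> by (intro Q_le) simp
    moreover have "y \<bullet> (s *\<^sub>R A) + \<beta> * (s * \<gamma> - t) = s * g - \<beta> * t"
      by (simp add: y_eq g_def algebra_simps inner_commute)
    ultimately show False using sg by simp
  qed
  moreover have "A \<bullet> x0 \<le> B + t" if "(A, B) \<in> K" for A B
  proof (rule field_le_epsilon)
    fix e :: real assume "e > 0"
    have "\<beta> * (- t - e) \<le> y \<bullet> A + \<beta> * B"
      using Kc[OF that] beta_le[OF \<open>e > 0\<close>] by (simp add: z_eq)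
    then have "\<beta> * (A \<bullet> x0) \<le> \<beta> * (B + t + e)"
      by (simp add: y_eq algebra_simps inner_commute)
    then show "A \<bullet> x0 \<le> B + t + e"
      using \<open>\<beta> > 0\<close> by simp
  qed
  ultimately show ?thesis by blast
qed

section \<open>Greedy sampling\<close>

text \<open>For \<open>y \<le> 1\<close> the quadratic \<open>1 + y + y\<^sup>2\<close> lies in
  between; for \<open>y > 1\<close> already \<open>y < y\<^sup>2\<close>. The linear term is kept
  separate so that it vanishes under an average with mean zero.\<close>

lemma exp_le_add_exp_square: "exp y \<le> y + exp (y\<^sup>2)" for y :: real
proof (cases "y \<le> 1")
  case True
  have "exp y \<le> 1 + y + y\<^sup>2"
  proof (cases "0 \<le> y")
    case True
    then show ?thesis using exp_bound \<open>y \<le> 1\<close> by blast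
  next
    case False
    \<comment> \<open>The linear terms cancel in the product, and for negative \<open>y\<close>
      every remaining term beyond 1 is nonnegative.\<close>
    have "1 \<le> (1 + y + y\<^sup>2) * (1 + (- y) + (- y)\<^sup>2 / 2)"
    proof -
      have "(1 + y + y\<^sup>2) * (1 + (- y) + (- y)\<^sup>2 / 2) = 1 + y\<^sup>2 / 2 + (- y) ^ 3 / 2 + y ^ 4 / 2"
        by (simp add: field_simps power2_eq_square power3_eq_cube power4_eq_xxxx)
      moreover have "0 \<le> (- y) ^ 3"
        using False by (intro zero_le_power) simp
      moreover have "0 \<le> y\<^sup>2 / 2" "0 \<le> y ^ 4 / 2"
        by simp_all
      ultimately show ?thesis by linarith
    qed
    also have "\<dots> \<le> (1 + y + y\<^sup>2) * exp (- y)"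
    proof (rule mult_left_mono)
      show "1 + (- y) + (- y)\<^sup>2 / 2 \<le> exp (- y)"
        using False by (intro exp_lower_Taylor_quadratic) simp
      have "1 + y + y\<^sup>2 = (1 + y / 2)\<^sup>2 + 3 / 4 * y\<^sup>2"
        by (simp add: field_simps power2_eq_square)
      then show "0 \<le> 1 + y + y\<^sup>2" by simp
    qed
    finally have "exp y * 1 \<le> exp y * ((1 + y + y\<^sup>2) * exp (- y))"
      by (intro mult_left_mono) auto
    also have "\<dots> = 1 + y + y\<^sup>2"
      by (simp add: exp_minus)
    finally show ?thesis by simp
  qed
  then show ?thesis
    using exp_ge_add_one_self[of "y\<^sup>2"] by linarith
next
  case False
  then have "exp y \<le> exp (y\<^sup>2)"
    by (simp add: power2_eq_square)
  then show ?thesis using False by linarith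
qed

text \<open>A Hoeffding-type bound on the exponential moment of a bounded variable with mean
  zero.\<close>

lemma sum_weighted_exp_le:
  fixes u y :: "'p \<Rightarrow> real"
  assumes "\<And>p. p \<in> P \<Longrightarrow> 0 \<le> u p" "sum u P = 1"
    and "(\<Sum>p\<in>P. u p * y p) = 0" "\<And>p. p \<in> P \<Longrightarrow> \<bar>y p\<bar> \<le> c"
  shows "(\<Sum>p\<in>P. u p * exp (y p)) \<le> exp (c\<^sup>2)"
proof -
  have "(\<Sum>p\<in>P. u p * exp (y p)) \<le> (\<Sum>p\<in>P. u p * (y p + exp (c\<^sup>2)))"
  proof (intro sum_mono mult_left_mono)
    fix p assume "p \<in> P"
    then have "(y p)\<^sup>2 \<le> c\<^sup>2"
      using assms(4) by (metis abs_ge_zero power2_abs power_mono)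
    then show "exp (y p) \<le> y p + exp (c\<^sup>2)"
      using exp_le_add_exp_square[of "y p"] exp_le_cancel_iff[of "(y p)\<^sup>2" "c\<^sup>2"] by linarith
  qed (use assms in auto)
  also have "\<dots> = exp (c\<^sup>2)"
    using assms by (simp add: distrib_left sum.distrib flip: sum_distrib_right)
  finally show ?thesis .
qed

lemma ex_le_weighted_mean:
  fixes u g :: "'p \<Rightarrow> real"
  assumes "\<And>p. p \<in> P \<Longrightarrow> 0 \<le> u p" "sum u P = 1" "(\<Sum>p\<in>P. u p * g p) \<le> c"
  shows "\<exists>p\<in>P. g p \<le> c"
proof (rule ccontr)
  assume "\<not> ?thesis"
  then have gt: "c < g p" if "p \<in> P" for p using that by force
  have fin: "finite P" using assms(2) by (metis sum.infinite zero_neq_one)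
  have "\<exists>p\<in>P. u p > 0"
    by (metis assms(1,2) antisym_conv2 sum.neutral zero_neq_one)
  then have "(\<Sum>p\<in>P. u p * c) < (\<Sum>p\<in>P. u p * g p)"
  proof (intro sum_strict_mono_ex1[OF fin] ballI)
    show "u p * c \<le> u p * g p" if "p \<in> P" for p
      using gt[OF that] assms(1)[OF that] by (intro mult_left_mono) auto
  qed (use gt in force)
  then show False
    using assms by (simp flip: sum_distrib_right)
qed

text \<open>For \<open>s \<ge> 0\<close> its logarithm is a smooth substitute for \<open>s\<close>
  times the maximum norm of \<open>v\<close>, exceeding it by at most
  \<open>ln (2 * CARD('d))\<close>; the two signs account for the absolute values.\<close>

definition exp_potential :: "real \<Rightarrow> real ^ 'd \<Rightarrow> real"
  where "exp_potential s v = (\<Sum>l\<in>UNIV. exp (s * v $ l) + exp (- (s * v $ l)))"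

lemma exp_potential_pos: "exp_potential s v > 0"
  unfolding exp_potential_def by (intro sum_pos) (auto intro: add_pos_pos)

lemma abs_nth_le_ln_exp_potential: "s * \<bar>v $ l\<bar> \<le> ln (exp_potential s v)" if "s \<ge> 0"
proof -
  have "exp (s * \<bar>v $ l\<bar>) \<le> exp (s * v $ l) + exp (- (s * v $ l))"
    by (cases "v $ l \<ge> 0") auto
  also have "\<dots> \<le> exp_potential s v"
    unfolding exp_potential_def
    by (rule member_le_sum[of l UNIV "\<lambda>l. exp (s * v $ l) + exp (- (s * v $ l))"])
       (auto intro: add_nonneg_nonneg)
  finally show ?thesis
    by (simp add: exp_potential_pos ln_ge_iff)
qed

text \<open>Each of the exponentials splits into its value at \<open>v\<close> and a factor in
  \<open>w p\<close>, whose average is an exponential moment with mean zero.\<close>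

lemma sum_weighted_exp_potential_le:
  fixes w :: "'p \<Rightarrow> real ^ 'd"
  assumes u: "\<And>p. p \<in> P \<Longrightarrow> 0 \<le> u p" "sum u P = 1"
    and w: "(\<Sum>p\<in>P. u p *\<^sub>R w p) = 0" "\<And>p l. p \<in> P \<Longrightarrow> \<bar>w p $ l\<bar> \<le> c"
  shows "(\<Sum>p\<in>P. u p * exp_potential s (v + w p)) \<le> exp ((s * c)\<^sup>2) * exp_potential s v"
proof -
  have coord: "(\<Sum>p\<in>P. u p * exp (\<sigma> * (v + w p) $ l)) \<le> exp ((s * c)\<^sup>2) * exp (\<sigma> * v $ l)"
    if "\<bar>\<sigma>\<bar> = \<bar>s\<bar>" for \<sigma> l
  proof -
    have "(\<Sum>p\<in>P. u p * w p $ l) = 0"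
      using arg_cong[OF w(1), of "\<lambda>z. z $ l"] by (simp add: sum_component)
    then have "(\<Sum>p\<in>P. u p * (\<sigma> * w p $ l)) = 0"
      by (simp add: mult.left_commute flip: sum_distrib_left)
    moreover have "\<bar>\<sigma> * w p $ l\<bar> \<le> \<bar>s\<bar> * c" if "p \<in> P" for p
      unfolding abs_mult \<open>\<bar>\<sigma>\<bar> = \<bar>s\<bar>\<close> using w(2)[OF that] by (intro mult_left_mono) auto
    ultimately have "(\<Sum>p\<in>P. u p * exp (\<sigma> * w p $ l)) \<le> exp ((\<bar>s\<bar> * c)\<^sup>2)"
      using u by (intro sum_weighted_exp_le) auto
    then have "(\<Sum>p\<in>P. u p * exp (\<sigma> * w p $ l)) * exp (\<sigma> * v $ l) \<le> exp ((s * c)\<^sup>2) * exp (\<sigma> * v $ l)"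
      by (simp add: power_mult_distrib)
    moreover have "(\<Sum>p\<in>P. u p * exp (\<sigma> * (v + w p) $ l)) = (\<Sum>p\<in>P. u p * exp (\<sigma> * w p $ l)) * exp (\<sigma> * v $ l)"
      unfolding sum_distrib_right by (intro sum.cong) (auto simp: distrib_left exp_add)
    ultimately show ?thesis by simp
  qed
  have "(\<Sum>p\<in>P. u p * exp_potential s (v + w p))
      = (\<Sum>l\<in>UNIV. (\<Sum>p\<in>P. u p * exp (s * (v + w p) $ l)) + (\<Sum>p\<in>P. u p * exp ((- s) * (v + w p) $ l)))"
    unfolding exp_potential_def sum_distrib_left
    by (subst sum.swap) (simp add: distrib_left sum.distrib)
  also have "\<dots> \<le> (\<Sum>l\<in>UNIV. exp ((s * c)\<^sup>2) * exp (s * v $ l) + exp ((s * c)\<^sup>2) * exp ((- s) * v $ l))"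
    by (intro sum_mono add_mono coord) auto
  also have "\<dots> = exp ((s * c)\<^sup>2) * exp_potential s v"
    by (simp add: exp_potential_def sum_distrib_left distrib_left)
  finally show ?thesis .
qed

text \<open>The weighted mean of the left side obeys the bound, hence so does some \<open>p\<close>.
  The logarithm is tracked, and not the potential itself, so that \<open>\<beta>\<close> enters
  additively and averages out whatever its size.\<close>

lemma exp_potential_step:
  fixes w :: "'p \<Rightarrow> real ^ 'd" and \<beta> :: "'p \<Rightarrow> real"
  assumes u: "\<And>p. p \<in> P \<Longrightarrow> 0 \<le> u p" "sum u P = 1"
    and w: "(\<Sum>p\<in>P. u p *\<^sub>R w p) = 0" "\<And>p l. p \<in> P \<Longrightarrow> \<bar>w p $ l\<bar> \<le> c"
    and \<beta>: "(\<Sum>p\<in>P. u p * \<beta> p) = 0"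
    and "R \<ge> 0"
  shows "\<exists>p\<in>P. R * ln (exp_potential s (v + w p)) + \<beta> p \<le> R * (ln (exp_potential s v) + (s * c)\<^sup>2)"
proof (rule ex_le_weighted_mean[OF u])
  define W where "W = exp ((s * c)\<^sup>2) * exp_potential s v"
  have "W > 0"
    by (simp add: W_def exp_potential_pos)
  have lnW: "ln W = ln (exp_potential s v) + (s * c)\<^sup>2"
    using exp_potential_pos[of s v] by (simp add: W_def ln_mult)
  have "(\<Sum>p\<in>P. u p * ln (exp_potential s (v + w p)))
      \<le> (\<Sum>p\<in>P. u p * (ln W - 1 + exp_potential s (v + w p) / W))"
  proof (intro sum_mono mult_left_mono)
    fix p
    \<comment> \<open>the tangent of \<open>ln\<close> at \<open>W\<close>\<close>
    have "ln (exp_potential s (v + w p) / W) \<le> exp_potential s (v + w p) / W - 1"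
      using \<open>W > 0\<close> by (intro ln_le_minus_one divide_pos_pos exp_potential_pos)
    then show "ln (exp_potential s (v + w p)) \<le> ln W - 1 + exp_potential s (v + w p) / W"
      using \<open>W > 0\<close> exp_potential_pos[of s "v + w p"] by (simp add: ln_div)
  qed (use u in auto)
  also have "\<dots> = ln W - 1 + (\<Sum>p\<in>P. u p * exp_potential s (v + w p)) / W"
    using u by (simp add: distrib_left sum.distrib sum_divide_distrib flip: sum_distrib_right)
  also have "\<dots> \<le> ln W"
    using sum_weighted_exp_potential_le[OF u w, of s v] \<open>W > 0\<close> by (simp add: W_def)
  finally have "R * (\<Sum>p\<in>P. u p * ln (exp_potential s (v + w p))) \<le> R * ln W"
    using \<open>R \<ge> 0\<close> by (rule mult_left_mono)
  moreover have "(\<Sum>p\<in>P. u p * (R * ln (exp_potential s (v + w p)) + \<beta> p))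
      = R * (\<Sum>p\<in>P. u p * ln (exp_potential s (v + w p)))"
    using \<beta> by (simp add: distrib_left sum.distrib sum_distrib_left mult.left_commute)
  ultimately show "(\<Sum>p\<in>P. u p * (R * ln (exp_potential s (v + w p)) + \<beta> p))
      \<le> R * (ln (exp_potential s v) + (s * c)\<^sup>2)"
    by (simp add: lnW)
qed

text \<open>The greedy step is iterated from the zero vector, where the potential is
  \<open>2 * CARD('d)\<close>; each draw costs \<open>(s * c)\<^sup>2\<close>.\<close>

lemma ex_exp_potential_sample:
  fixes w :: "'p \<Rightarrow> real ^ 'd" and \<beta> :: "'p \<Rightarrow> real" and n :: nat
  assumes u: "\<And>p. p \<in> P \<Longrightarrow> 0 \<le> u p" "sum u P = 1"
    and w: "(\<Sum>p\<in>P. u p *\<^sub>R w p) = 0" "\<And>p l. p \<in> P \<Longrightarrow> \<bar>w p $ l\<bar> \<le> c"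
    and \<beta>: "(\<Sum>p\<in>P. u p * \<beta> p) = 0"
    and R: "R \<ge> 0"
  shows "\<exists>f. (\<forall>i<n. f i \<in> P) \<and>
    R * ln (exp_potential s (\<Sum>i<n. w (f i))) + (\<Sum>i<n. \<beta> (f i))
      \<le> R * (ln (2 * real CARD('d)) + real n * (s * c)\<^sup>2)"
proof (induction n)
  case 0
  show ?case by (simp add: exp_potential_def mult.commute)
next
  case (Suc n)
  then obtain f where f: "\<forall>i<n. f i \<in> P"
    "R * ln (exp_potential s (\<Sum>i<n. w (f i))) + (\<Sum>i<n. \<beta> (f i))
      \<le> R * (ln (2 * real CARD('d)) + real n * (s * c)\<^sup>2)"
    by blast
  obtain p where p: "p \<in> P" "R * ln (exp_potential s ((\<Sum>i<n. w (f i)) + w p)) + \<beta> p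
      \<le> R * (ln (exp_potential s (\<Sum>i<n. w (f i))) + (s * c)\<^sup>2)"
    using exp_potential_step[OF u w \<beta> R] by blast
  have eqs: "(\<Sum>i<n. w ((f(n := p)) i)) = (\<Sum>i<n. w (f i))"
    "(\<Sum>i<n. \<beta> ((f(n := p)) i)) = (\<Sum>i<n. \<beta> (f i))"
    by (auto intro!: sum.cong)
  show ?case
  proof (intro exI[of _ "f(n := p)"] conjI)
    show "\<forall>i<Suc n. (f(n := p)) i \<in> P"
      using f(1) p(1) by (auto simp: less_Suc_eq)
    show "R * ln (exp_potential s (\<Sum>i<Suc n. w ((f(n := p)) i))) + (\<Sum>i<Suc n. \<beta> ((f(n := p)) i))
      \<le> R * (ln (2 * real CARD('d)) + real (Suc n) * (s * c)\<^sup>2)"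
      unfolding sum.lessThan_Suc eqs using f(2) p(2) by (simp add: algebra_simps)
  qed
qed

text \<open>
  The estimate is one-sided in the second components: these may be arbitrarily large, so their
  sample mean need not be close to \<open>B\<close>.
\<close>

lemma convex_hull_sample:
  fixes P :: "((real ^ 'd) \<times> real) set" and n :: nat
  assumes "finite P" and P: "\<And>A B l. (A, B) \<in> P \<Longrightarrow> \<bar>A $ l\<bar> \<le> 1"
    and AB: "(A, B) \<in> convex hull P" and "R \<ge> 0" "s > 0"
  shows "\<exists>f. (\<forall>i<n. f i \<in> P) \<and> (\<forall>x. l1_norm x \<le> R \<longrightarrow>
    real n * (A \<bullet> x - B) \<le> (\<Sum>i<n. fst (f i) \<bullet> x - snd (f i))
      + R * (ln (2 * real CARD('d)) / s + 4 * real n * s))"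
proof -
  obtain u where u: "\<And>p. p \<in> P \<Longrightarrow> 0 \<le> u p" "sum u P = 1" and comb: "(\<Sum>p\<in>P. u p *\<^sub>R p) = (A, B)"
    using AB unfolding convex_hull_finite[OF \<open>finite P\<close>] by blast
  have A: "(\<Sum>p\<in>P. u p *\<^sub>R fst p) = A" and B: "(\<Sum>p\<in>P. u p * snd p) = B"
    using arg_cong[OF comb, of fst] arg_cong[OF comb, of snd] by (simp_all add: fst_sum snd_sum)
  have A_le: "\<bar>A $ l\<bar> \<le> 1" for l
  proof -
    have "A $ l = (\<Sum>p\<in>P. u p * fst p $ l)"
      by (simp flip: A)
    then have "\<bar>A $ l\<bar> \<le> (\<Sum>p\<in>P. \<bar>u p * fst p $ l\<bar>)"
      by simp
    also have "\<dots> \<le> (\<Sum>p\<in>P. u p * 1)"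
      unfolding abs_mult using u P by (intro sum_mono mult_mono) auto
    finally show ?thesis using u by simp
  qed
  define w where "w p = A - fst p" for p :: "(real ^ 'd) \<times> real"
  \<comment> \<open>The factor \<open>s\<close> matches the scale of the potential, whose logarithm
    controls \<open>s\<close> times the sampling error of the first components. The signs of
    \<open>w\<close> and \<open>\<beta>\<close> make the two errors add up to that of
    \<open>A \<bullet> x - B\<close>.\<close>
  define \<beta> where "\<beta> p = s * (snd p - B)" for p :: "(real ^ 'd) \<times> real"
  have "(\<Sum>p\<in>P. u p *\<^sub>R w p) = 0"
    using u A by (simp add: w_def scaleR_diff_right sum_subtractf flip: scaleR_sum_left)
  \<comment> \<open>Both \<open>A\<close> and \<open>fst p\<close> lie in the cube; the square of
    this 2 becomes the 4 in the error term.\<close>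
  moreover have "\<bar>w p $ l\<bar> \<le> 2" if "p \<in> P" for p l
    using P[of "fst p" "snd p" l] A_le[of l] that by (auto simp: w_def)
  moreover have "(\<Sum>p\<in>P. u p * \<beta> p) = 0"
  proof -
    have "(\<Sum>p\<in>P. u p * \<beta> p) = s * ((\<Sum>p\<in>P. u p * snd p) - (\<Sum>p\<in>P. u p) * B)"
      unfolding \<beta>_def sum_distrib_right sum_subtractf[symmetric] sum_distrib_left
      by (intro sum.cong) (auto simp: algebra_simps)
    then show ?thesis using u B by simp
  qed
  ultimately obtain f where fP: "\<forall>i<n. f i \<in> P" and
    f: "R * ln (exp_potential s (\<Sum>i<n. w (f i))) + (\<Sum>i<n. \<beta> (f i))
      \<le> R * (ln (2 * real CARD('d)) + real n * (s * 2)\<^sup>2)"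
    using ex_exp_potential_sample[OF u, of w 2 \<beta> R n s] \<open>R \<ge> 0\<close> by blast
  have "real n * (A \<bullet> x - B) \<le> (\<Sum>i<n. fst (f i) \<bullet> x - snd (f i))
      + R * (ln (2 * real CARD('d)) / s + 4 * real n * s)" if "l1_norm x \<le> R" for x
  proof -
    define V where "V = (\<Sum>i<n. w (f i))"
    define L where "L = ln (exp_potential s V)"
    have L_ge: "s * \<bar>V $ l\<bar> \<le> L" for l
      using abs_nth_le_ln_exp_potential[of s V l] \<open>s > 0\<close> by (simp add: L_def)
    then have "L \<ge> 0"
      using \<open>s > 0\<close> by (meson abs_ge_zero less_imp_le mult_nonneg_nonneg order_trans)
    have "V \<bullet> x \<le> L / s * l1_norm x"
      using L_ge \<open>s > 0\<close> by (intro inner_le_l1_norm) (simp add: field_simps)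
    also have "\<dots> \<le> L / s * R"
      using that \<open>L \<ge> 0\<close> \<open>s > 0\<close> by (intro mult_left_mono) auto
    finally have "s * (V \<bullet> x) \<le> R * L"
      using \<open>s > 0\<close> by (simp add: field_simps)
    moreover have "V \<bullet> x = real n * (A \<bullet> x) - (\<Sum>i<n. fst (f i) \<bullet> x)"
      unfolding V_def w_def inner_sum_left inner_diff_left sum_subtractf by simp
    ultimately have "s * (real n * (A \<bullet> x) - (\<Sum>i<n. fst (f i) \<bullet> x)) \<le> R * L"
      by simp
    moreover have "(\<Sum>i<n. \<beta> (f i)) = s * ((\<Sum>i<n. snd (f i)) - real n * B)"
      by (simp add: \<beta>_def sum_subtractf flip: sum_distrib_left)
    ultimately have "s * (real n * (A \<bullet> x - B) - (\<Sum>i<n. fst (f i) \<bullet> x - snd (f i)))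
        \<le> R * (ln (2 * real CARD('d)) + real n * (s * 2)\<^sup>2)"
      using f unfolding L_def V_def sum_subtractf by (simp add: algebra_simps)
    also have "\<dots> = s * (R * (ln (2 * real CARD('d)) / s + 4 * real n * s))"
      using \<open>s > 0\<close> by (simp add: field_simps power2_eq_square)
    finally show ?thesis
      using \<open>s > 0\<close> by simp
  qed
  with fP show ?thesis by blast
qed

section \<open>From local to global solutions\<close>

text \<open>A sample of \<open>k\<close> signed constraints involves at most \<open>k\<close>
  indices, so one local solution satisfies all of it up to \<open>r\<close>.\<close>

lemma local_to_global_sampling:
  fixes a :: "nat \<Rightarrow> real ^ 'd" and b :: "nat \<Rightarrow> real"
  assumes a_cube: "\<And>i l. i \<in> {1..m} \<Longrightarrow> \<bar>a i $ l\<bar> \<le> 1"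
    and k: "k \<in> {1..m}" and "R \<ge> 0" and d: "CARD('d) \<ge> 2"
    and local: "\<And>J. J \<subseteq> {1..m} \<Longrightarrow> card J = k \<Longrightarrow>
      \<exists>x. l1_norm x \<le> R \<and> (\<forall>j\<in>J. \<bar>a j \<bullet> x - b j\<bar> \<le> r)"
  shows "\<exists>x. l1_norm x \<le> R \<and>
    (\<forall>i\<in>{1..m}. \<bar>a i \<bullet> x - b i\<bar> \<le> r + 6 * R * sqrt (ln (real CARD('d)) / real k))"
proof -
  \<comment> \<open>Up to constants this balances the error terms
    \<open>ln (2 * real CARD('d)) / s\<close> and \<open>4 * real k * s\<close>; it is positive
    because \<open>CARD('d) \<ge> 2\<close>.\<close>
  define s where "s = sqrt (ln (real CARD('d)) / real k)"
  have "s > 0" and s2: "s\<^sup>2 = ln (real CARD('d)) / real k"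
    using d k by (simp_all add: s_def)
  \<comment> \<open>Both signs are included so that one-sided inequalities on \<open>P\<close>
    express the absolute values.\<close>
  define P where "P = (\<lambda>(\<sigma>, i). (\<sigma> *\<^sub>R a i, \<sigma> * b i)) ` ({- 1, 1} \<times> {1..m})"
  define t where "t = r + 6 * R * s"
  have "\<exists>x\<in>{x. l1_norm x \<le> R}. \<forall>(A, B)\<in>convex hull P. A \<bullet> x \<le> B + t"
  proof (rule affine_minimax_le)
    show "convex hull P \<noteq> {}"
      using k by (auto simp: P_def)
    fix A B assume AB: "(A, B) \<in> convex hull P"
    have "finite P" by (simp add: P_def)
    moreover have "\<bar>A $ l\<bar> \<le> 1" if "(A, B) \<in> P" for A B l
      using that a_cube by (auto simp: P_def)
    ultimately obtain f where fP: "\<forall>i<k. f i \<in> P" and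
      f: "\<forall>x. l1_norm x \<le> R \<longrightarrow> real k * (A \<bullet> x - B) \<le> (\<Sum>i<k. fst (f i) \<bullet> x - snd (f i))
        + R * (ln (2 * real CARD('d)) / s + 4 * real k * s)"
      using convex_hull_sample[OF _ _ AB \<open>R \<ge> 0\<close> \<open>s > 0\<close>, of k] by blast
    have "\<forall>i\<in>{..<k}. \<exists>q. q \<in> {- 1, 1} \<times> {1..m} \<and> f i = (fst q *\<^sub>R a (snd q), fst q * b (snd q))"
    proof
      fix i assume "i \<in> {..<k}"
      then have "f i \<in> P" using fP by simp
      then show "\<exists>q. q \<in> {- 1, 1} \<times> {1..m} \<and> f i = (fst q *\<^sub>R a (snd q), fst q * b (snd q))"
        unfolding P_def image_iff case_prod_beta by blast
    qed
    from bchoice[OF this] obtain q where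
      q: "\<And>i. i < k \<Longrightarrow> q i \<in> {- 1, 1} \<times> {1..m}"
        "\<And>i. i < k \<Longrightarrow> f i = (fst (q i) *\<^sub>R a (snd (q i)), fst (q i) * b (snd (q i)))"
      by auto
    define I where "I = (\<lambda>i. snd (q i)) ` {..<k}"
    have "card I \<le> k"
      using card_image_le[of "{..<k}" "\<lambda>i. snd (q i)"] by (simp add: I_def)
    moreover have "I \<subseteq> {1..m}"
      using q(1) by (auto simp: I_def mem_Times_iff)
    \<comment> \<open>Indices may repeat in the sample, so \<open>I\<close> is padded to size
      exactly \<open>k\<close>.\<close>
    ultimately obtain J where J: "I \<subseteq> J" "J \<subseteq> {1..m}" "card J = k"
      using exists_subset_between[of I k "{1..m}"] k by auto
    obtain x where x: "l1_norm x \<le> R" "\<forall>j\<in>J. \<bar>a j \<bullet> x - b j\<bar> \<le> r"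
      using local[OF J(2,3)] by blast
    have "fst (f i) \<bullet> x - snd (f i) \<le> r" if "i < k" for i
    proof -
      have "snd (q i) \<in> J"
        using J(1) that by (auto simp: I_def)
      then have "\<bar>a (snd (q i)) \<bullet> x - b (snd (q i))\<bar> \<le> r"
        using x(2) by simp
      moreover have "fst (q i) = - 1 \<or> fst (q i) = 1"
        using q(1)[OF that] by (simp add: mem_Times_iff)
      ultimately show ?thesis
        by (auto simp: q(2)[OF that])
    qed
    then have "(\<Sum>i<k. fst (f i) \<bullet> x - snd (f i)) \<le> real k * r"
      using sum_mono[of "{..<k}" "\<lambda>i. fst (f i) \<bullet> x - snd (f i)" "\<lambda>_. r"] by simp
    moreover have "ln (2 * real CARD('d)) / s + 4 * real k * s \<le> 6 * real k * s"
    proof -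
      \<comment> \<open>Here \<open>2 \<le> CARD('d)\<close> absorbs the \<open>ln 2\<close>; the
        first term contributes 2 and the second 4 to the constant 6.\<close>
      have "ln (2 * real CARD('d)) \<le> 2 * ln (real CARD('d))"
        using d by (simp add: ln_mult)
      also have "\<dots> = 2 * real k * s * s"
        using s2 k by (simp add: power2_eq_square field_simps)
      finally show ?thesis
        using \<open>s > 0\<close> by (simp add: divide_le_eq mult_ac)
    qed
    then have "R * (ln (2 * real CARD('d)) / s + 4 * real k * s) \<le> R * (6 * real k * s)"
      using \<open>R \<ge> 0\<close> by (rule mult_left_mono)
    ultimately have "real k * (A \<bullet> x - B) \<le> real k * t"
      using f[rule_format, OF x(1)] by (simp add: t_def algebra_simps)
    then have "A \<bullet> x \<le> B + t"
      using k by simp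
    with x(1) show "\<exists>x\<in>{x. l1_norm x \<le> R}. A \<bullet> x \<le> B + t" by blast
  qed (simp_all add: convex_l1_ball compact_l1_ball)
  then obtain x where x: "l1_norm x \<le> R" and hull: "\<forall>(A, B)\<in>convex hull P. A \<bullet> x \<le> B + t"
    by auto
  have PB: "A \<bullet> x \<le> B + t" if "(A, B) \<in> P" for A B
    using hull hull_inc[OF that, of convex] by auto
  have "\<bar>a i \<bullet> x - b i\<bar> \<le> t" if "i \<in> {1..m}" for i
    using PB[of "a i" "b i"] PB[of "- a i" "- b i"] that by (force simp: P_def)
  with x show ?thesis by (auto simp: t_def s_def)
qed

text \<open>The solution sets of the single constraints in the ball are convex, and any
  \<open>CARD('d) + 1 \<le> k\<close> of them meet, so Helly's theorem applies.\<close>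

lemma local_to_global_helly:
  fixes a :: "nat \<Rightarrow> real ^ 'd" and b :: "nat \<Rightarrow> real"
  assumes k: "k \<le> m" and d: "CARD('d) < k"
    and local: "\<And>J. J \<subseteq> {1..m} \<Longrightarrow> card J = k \<Longrightarrow>
      \<exists>x. l1_norm x \<le> R \<and> (\<forall>j\<in>J. \<bar>a j \<bullet> x - b j\<bar> \<le> r)"
  shows "\<exists>x. l1_norm x \<le> R \<and> (\<forall>i\<in>{1..m}. \<bar>a i \<bullet> x - b i\<bar> \<le> r)"
proof -
  define C where "C i = {x. l1_norm x \<le> R} \<inter> {x. \<bar>a i \<bullet> x - b i\<bar> \<le> r}" for i
  have conv: "convex (C i)" for i
  proof -
    have "{x. \<bar>a i \<bullet> x - b i\<bar> \<le> r} = {x. a i \<bullet> x \<le> b i + r} \<inter> {x. a i \<bullet> x \<ge> b i - r}"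
      by auto
    then show ?thesis
      unfolding C_def
      by (simp add: convex_Int convex_l1_ball convex_halfspace_le convex_halfspace_ge)
  qed
  have meet: "\<Inter> T \<noteq> {}" if T: "T \<subseteq> C ` {1..m}" "card T \<le> k" for T
  proof -
    \<comment> \<open>Different indices can give the same set, so one index is chosen for each
      member of \<open>T\<close>.\<close>
    obtain I where I: "I \<subseteq> {1..m}" "inj_on C I" "T = C ` I"
      using T(1) unfolding subset_image_inj by metis
    have "card I \<le> k"
      using T(2) I card_image by metis
    then obtain J where J: "I \<subseteq> J" "J \<subseteq> {1..m}" "card J = k"
      using exists_subset_between[of I k "{1..m}"] I k by auto
    obtain x where "l1_norm x \<le> R" "\<forall>j\<in>J. \<bar>a j \<bullet> x - b j\<bar> \<le> r"
      using local[OF J(2,3)] by blast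
    then have "x \<in> C i" if "i \<in> I" for i
      using J(1) that by (auto simp: C_def)
    then have "x \<in> \<Inter> T"
      unfolding I(3) by blast
    then show ?thesis by (metis empty_iff)
  qed
  have "\<Inter> (C ` {1..m}) \<noteq> {}"
  \<comment> \<open>Coinciding sets can leave fewer than the \<open>CARD('d) + 1\<close> that
    \<open>Helly\<close> asks for; then the whole family has at most \<open>k\<close> members and
    \<open>meet\<close> covers it.\<close>
  proof (cases "DIM(real ^ 'd) + 1 \<le> card (C ` {1..m})")
    case True
    show ?thesis
    proof (rule Helly[OF True])
      show "\<forall>s\<in>C ` {1..m}. convex s" using conv by blast
      show "\<And>T. T \<subseteq> C ` {1..m} \<Longrightarrow> card T = DIM(real ^ 'd) + 1 \<Longrightarrow> \<Inter> T \<noteq> {}"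
        using d by (intro meet) auto
    qed
  next
    case False
    then show ?thesis using d by (intro meet) auto
  qed
  then obtain x where "\<And>i. i \<in> {1..m} \<Longrightarrow> x \<in> C i" by blast
  moreover have "1 \<in> {1..m}" using d k by auto
  ultimately show ?thesis by (intro exI[of _ x]) (auto simp: C_def)
qed

theorem theorem1p2:
  fixes a :: "nat \<Rightarrow> real ^ 'd" and b :: "nat \<Rightarrow> real"
    and m k :: nat and R r :: real
  assumes a_cube: "\<forall>i\<in>{1..m}. \<forall>l. a i $ l \<in> {-1..1}"
    and k_range: "k \<in> {1..m}"
    and R_ge: "R \<ge> 1"
    and r_ge: "r \<ge> 0"
    and nondegenerate: "CARD('d) \<ge> 2 \<or> k \<ge> 2 \<or> m = 1"
    and local_solutions:
      "\<forall>J. J \<subseteq> {1..m} \<and> card J = k \<longrightarrow>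
        (\<exists>x :: real ^ 'd. l1_norm x \<le> R \<and> (MAX j\<in>J. \<bar>a j \<bullet> x - b j\<bar>) \<le> r)"
  shows "\<exists>x :: real ^ 'd. l1_norm x \<le> exp 1 * R \<and>
    (MAX i\<in>{1..m}. \<bar>a i \<bullet> x - b i\<bar>) \<le> r + 21 * R * sqrt (ln (real CARD('d)) / real k)"
proof -
  define s where "s = sqrt (ln (real CARD('d)) / real k)"
  have "s \<ge> 0"
    by (simp add: s_def Suc_le_eq)
  then have Rs: "0 \<le> R * s"
    using R_ge by simp
  have local: "\<exists>x. l1_norm x \<le> R \<and> (\<forall>j\<in>J. \<bar>a j \<bullet> x - b j\<bar> \<le> r)"
    if J: "J \<subseteq> {1..m}" "card J = k" for J
  proof -
    obtain x where x: "l1_norm x \<le> R" "(MAX j\<in>J. \<bar>a j \<bullet> x - b j\<bar>) \<le> r"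
      using local_solutions J by blast
    have "finite J"
      using J(1) by (rule finite_subset) simp
    then have "\<bar>a j \<bullet> x - b j\<bar> \<le> (MAX j\<in>J. \<bar>a j \<bullet> x - b j\<bar>)" if "j \<in> J" for j
      using that by (intro Max_ge) auto
    with x show ?thesis by (meson order_trans)
  qed
  have "\<exists>x. l1_norm x \<le> R \<and> (\<forall>i\<in>{1..m}. \<bar>a i \<bullet> x - b i\<bar> \<le> r + 6 * R * s)"
  proof -
    \<comment> \<open>If \<open>CARD('d) \<ge> 2\<close> fails, the dimension is 1, and
      \<open>k \<ge> 2\<close> exceeds it. When \<open>m = 1\<close>, also \<open>k = 1\<close>, and
      the full index set is itself local.\<close>
    consider "CARD('d) \<ge> 2" | "CARD('d) < k" | "m = 1"
      using nondegenerate by linarith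
    then show ?thesis
    proof cases
      case 1
      then show ?thesis
        unfolding s_def
        using local_to_global_sampling[of m a k R b r] a_cube k_range R_ge local
        by (auto simp: abs_le_iff minus_le_iff)
    next
      case 2
      then obtain x where "l1_norm x \<le> R" "\<forall>i\<in>{1..m}. \<bar>a i \<bullet> x - b i\<bar> \<le> r"
        using local_to_global_helly[of k m R a b r] k_range local by auto
      then show ?thesis using Rs by (intro exI[of _ x]) force
    next
      case 3
      then obtain x where "l1_norm x \<le> R" "\<forall>i\<in>{1..m}. \<bar>a i \<bullet> x - b i\<bar> \<le> r"
        using local[of "{1..m}"] k_range by auto
      then show ?thesis using Rs by (intro exI[of _ x]) force
    qed
  qed
  then obtain x where x: "l1_norm x \<le> R" "\<forall>i\<in>{1..m}. \<bar>a i \<bullet> x - b i\<bar> \<le> r + 6 * R * s"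
    by blast
  have "1 * R \<le> exp 1 * R"
    using R_ge by (intro mult_right_mono) auto
  then have "l1_norm x \<le> exp 1 * R"
    using x(1) by simp
  moreover have "(MAX i\<in>{1..m}. \<bar>a i \<bullet> x - b i\<bar>) \<le> r + 21 * R * s"
  proof (rule Max.boundedI)
    fix y assume "y \<in> (\<lambda>i. \<bar>a i \<bullet> x - b i\<bar>) ` {1..m}"
    then show "y \<le> r + 21 * R * s"
      using x(2) Rs by force
  qed (use k_range in auto)
  ultimately show ?thesis
    unfolding s_def by blast
qed

end
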